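(* Let $(\Gamma,X)$ be a graph with vertex set $X=\{1,\dots,n\}$, $|X|\ge 3$, and let $u:X\to(E,\alpha)$ be a reduced and non-trivial representation of $(\Gamma,X)$ with parameters $(\omega,c)$ in a quadratic space $(E,\alpha)$. Let $\mathcal{G}(u)=\{\langle u_1\rangle,\dots,\langle u_n\rangle\}$ be the associated set of lines, $G$ the group of pairs $(\sigma,\nu)$ and $f:G\to\mathrm{Aut}(\mathcal{G}(u))$, $(\sigma,\nu)\mapsto f_{\sigma,\nu}$, the group homomorphism defined in the context, with image $G(u)$. 1. If the lines $\langle u_1\rangle,\dots,\langle u_n\rangle$ are pairwise distinct, then $f:G\to \mathrm{Aut}(\mathcal{G}(u))$ is an isomorphism, and $$G\simeq G(u)=\mathrm{Aut}(\mathcal{G}(u)).$$ 2. If $|\omega|\neq|c|$, then the lines $\langle u_1\rangle,\dots,\langle u_n\rangle$ are pairwise distinct.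
   Context: A graph $(\Gamma,X)$ is a finite simple graph: $X=\{1,\dots,n\}$ is the vertex set and $\Gamma$, the set of edges, is a set of pairs of distinct points of $X$. For $i,j\in X$ put $\varepsilon_{i,j}=-1$ if $\{i,j\}\in\Gamma$ and $\varepsilon_{i,j}=1$ otherwise (in particular $\varepsilon_{i,i}=1$). A quadratic space $(E,\alpha)$ is a finite-dimensional real vector space with a symmetric bilinear form $\alpha$. A representation of $(\Gamma,X)$ with parameters $(\omega,c)\in\mathbb{R}^2$ is a map $u:X\to(E,\alpha)$, $i\mapsto u_i$, such that $\alpha(u_i,u_i)=\omega$ for all $i$ and $\alpha(u_i,u_j)=\varepsilon_{i,j}\,c$ for all $i\neq j$. It is reduced if $\dim E$ equals the rank of the matrix $(\alpha(u_i,u_j))_{i,j\in X}$ (then the $u_i$ span $E$ and $\alpha$ is non-degenerate). It is trivial if $c=0$, non-trivial if $c\neq0$. $\mathrm{Aut}(\mathcal{G}(u))$ is the group of all isometries $\varphi$ of $(E,\alpha)$ (linear bijections preserving $\alpha$) that induce a permutation of the set of lines $\mathcal{G}(u)$ via $\langle u_i\rangle\mapsto\langle\varphi(u_i)\rangle$. $G$ is the set of pairs $(\sigma,\nu)\in\mathcal{S}_X\times\{-1,1\}^n$ ($\mathcal{S}_X$ the group of permutations of $X$, $\nu=(\nu_1,\dots,\nu_n)$) such that $\nu_i\nu_j\,\varepsilon_{\sigma(i),\sigma(j)}=\varepsilon_{i,j}$ for all $i,j\in X$. It is a group under $(\sigma,\nu)*(\sigma',\nu')=(\sigma\circ\sigma',\nu^{\sigma'}\nu')$,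 where $(\nu^{\sigma'})_i=\nu_{\sigma'(i)}$ and the product of $n$-tuples is componentwise. For $(\sigma,\nu)\in G$, $f_{\sigma,\nu}$ denotes the unique isometry of $(E,\alpha)$ with $f_{\sigma,\nu}(u_i)=\nu_i u_{\sigma(i)}$ for all $i\in X$; it lies in $\mathrm{Aut}(\mathcal{G}(u))$, and $(\sigma,\nu)\mapsto f_{\sigma,\nu}$ is a group homomorphism $f:G\to\mathrm{Aut}(\mathcal{G}(u))$, whose image is denoted $G(u)$. *)

theory Defs
  imports "HOL-Analysis.Analysis" "HOL-Algebra.Group"
begin

text \<open>The vertex set \<open>{1,\<dots>,n}\<close> is represented by the universe of a finite type \<open>'n\<close>.\<close>

definition simple_graph :: "'n::finite set set \<Rightarrow> bool"
  where "simple_graph \<Gamma> \<longleftrightarrow> (\<forall>e\<in>\<Gamma>. \<exists>i j. i \<noteq> j \<and> e = {i, j})"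

definition sgn_adj :: "'n::finite set set \<Rightarrow> 'n \<Rightarrow> 'n \<Rightarrow> real"
  where "sgn_adj \<Gamma> i j = (if {i, j} \<in> \<Gamma> then -1 else 1)"

definition quadratic_space :: "('a::real_vector \<Rightarrow> 'a \<Rightarrow> real) \<Rightarrow> bool"
  where "quadratic_space \<alpha> \<longleftrightarrow>
    (\<exists>B::'a set. finite B \<and> span B = UNIV) \<and> bilinear \<alpha> \<and> (\<forall>x y. \<alpha> x y = \<alpha> y x)"

definition graph_representation ::
    "'n::finite set set \<Rightarrow> ('a::real_vector \<Rightarrow> 'a \<Rightarrow> real) \<Rightarrow> ('n \<Rightarrow> 'a) \<Rightarrow> real \<Rightarrow> real \<Rightarrow> bool"
  where "graph_representation \<Gamma> \<alpha> u \<omega> c \<longleftrightarrow>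
    (\<forall>i. \<alpha> (u i) (u i) = \<omega>) \<and> (\<forall>i j. i \<noteq> j \<longrightarrow> \<alpha> (u i) (u j) = sgn_adj \<Gamma> i j * c)"

definition gram :: "('a::real_vector \<Rightarrow> 'a \<Rightarrow> real) \<Rightarrow> ('n::finite \<Rightarrow> 'a) \<Rightarrow> real^'n^'n"
  where "gram \<alpha> u = (\<chi> i j. \<alpha> (u i) (u j))"

definition reduced_representation :: "('a::real_vector \<Rightarrow> 'a \<Rightarrow> real) \<Rightarrow> ('n::finite \<Rightarrow> 'a) \<Rightarrow> bool"
  where "reduced_representation \<alpha> u \<longleftrightarrow> dim (UNIV :: 'a set) = rank (gram \<alpha> u)"

definition isometry :: "('a::real_vector \<Rightarrow> 'a \<Rightarrow> real) \<Rightarrow> ('a \<Rightarrow> 'a) \<Rightarrow> bool"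
  where "isometry \<alpha> \<phi> \<longleftrightarrow> linear \<phi> \<and> bij \<phi> \<and> (\<forall>x y. \<alpha> (\<phi> x) (\<phi> y) = \<alpha> x y)"

definition line :: "('n \<Rightarrow> 'a::real_vector) \<Rightarrow> 'n \<Rightarrow> 'a set"
  where "line u i = span {u i}"

definition lines :: "('n \<Rightarrow> 'a::real_vector) \<Rightarrow> 'a set set"
  where "lines u = range (line u)"

text \<open>
  For linear \<open>\<phi>\<close>, the image of \<open>span {u i}\<close> under \<open>\<phi>\<close> is \<open>span {\<phi> (u i)}\<close>
  (see \<open>image_line\<close>), so the map that \<open>\<phi>\<close> induces on lines is the image map.
\<close>

definition Aut_lines :: "('a::real_vector \<Rightarrow> 'a \<Rightarrow> real) \<Rightarrow> ('n \<Rightarrow> 'a) \<Rightarrow> ('a \<Rightarrow> 'a) monoid"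
  where "Aut_lines \<alpha> u =
    \<lparr>carrier = {\<phi>. isometry \<alpha> \<phi> \<and> bij_betw (\<lambda>L. \<phi> ` L) (lines u) (lines u)},
     monoid.mult = (\<circ>), one = id\<rparr>"

definition sgn_perm_group :: "'n::finite set set \<Rightarrow> (('n \<Rightarrow> 'n) \<times> ('n \<Rightarrow> real)) monoid"
  where "sgn_perm_group \<Gamma> =
    \<lparr>carrier = {(\<sigma>, \<nu>). bij \<sigma> \<and> (\<forall>i. \<nu> i \<in> {-1, 1}) \<and>
        (\<forall>i j. \<nu> i * \<nu> j * sgn_adj \<Gamma> (\<sigma> i) (\<sigma> j) = sgn_adj \<Gamma> i j)},
     monoid.mult = (\<lambda>(\<sigma>, \<nu>) (\<sigma>', \<nu>'). (\<sigma> \<circ> \<sigma>', \<lambda>i. \<nu> (\<sigma>' i) * \<nu>' i)),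
     one = (id, \<lambda>_. 1)\<rparr>"

text \<open>Existence and uniqueness are proved in \<open>ex1_induced_isometry\<close>.\<close>

definition induced_isometry ::
    "('a::real_vector \<Rightarrow> 'a \<Rightarrow> real) \<Rightarrow> ('n::finite \<Rightarrow> 'a) \<Rightarrow> ('n \<Rightarrow> 'n) \<times> ('n \<Rightarrow> real) \<Rightarrow> 'a \<Rightarrow> 'a"
  where "induced_isometry \<alpha> u =
    (\<lambda>(\<sigma>, \<nu>). THE \<phi>. isometry \<alpha> \<phi> \<and> (\<forall>i. \<phi> (u i) = \<nu> i *\<^sub>R u (\<sigma> i)))"

definition rep_group ::
    "'n::finite set set \<Rightarrow> ('a::real_vector \<Rightarrow> 'a \<Rightarrow> real) \<Rightarrow> ('n \<Rightarrow> 'a) \<Rightarrow> ('a \<Rightarrow> 'a) monoid"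
  where "rep_group \<Gamma> \<alpha> u =
    (Aut_lines \<alpha> u)\<lparr>carrier := induced_isometry \<alpha> u ` carrier (sgn_perm_group \<Gamma>)\<rparr>"


lemma image_line:
  assumes "linear \<phi>"
  shows "\<phi> ` line u i = line (\<phi> \<circ> u) i"
  using linear_span_image[OF assms, of "{u i}"] by (simp add: line_def)

lemma group_Aut_lines: "group (Aut_lines \<alpha> u)"
proof (rule groupI)
  fix x y assume x: "x \<in> carrier (Aut_lines \<alpha> u)" and y: "y \<in> carrier (Aut_lines \<alpha> u)"
  have "bij_betw ((\<lambda>L. x ` L) \<circ> (\<lambda>L. y ` L)) (lines u) (lines u)"
    using x y by (intro bij_betw_trans) (auto simp: Aut_lines_def)
  moreover have "((\<lambda>L. x ` L) \<circ> (\<lambda>L. y ` L)) = (\<lambda>L. (x \<circ> y) ` L)"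
    by (auto simp: fun_eq_iff)
  ultimately have "bij_betw (\<lambda>L. (x \<circ> y) ` L) (lines u) (lines u)"
    by simp
  then show "x \<otimes>\<^bsub>Aut_lines \<alpha> u\<^esub> y \<in> carrier (Aut_lines \<alpha> u)"
    using x y by (simp add: Aut_lines_def isometry_def bij_comp linear_compose del: o_apply)
      (simp add: o_def)
next
  show "\<one>\<^bsub>Aut_lines \<alpha> u\<^esub> \<in> carrier (Aut_lines \<alpha> u)"
    by (auto simp: Aut_lines_def isometry_def linear_id[unfolded id_def] id_def bij_betw_def inj_on_def)
next
  fix x assume x: "x \<in> carrier (Aut_lines \<alpha> u)"
  then have lin: "linear x" and bij: "bij x" and iso: "\<And>a b. \<alpha> (x a) (x b) = \<alpha> a b"
    and L: "bij_betw (\<lambda>L. x ` L) (lines u) (lines u)"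
    by (auto simp: Aut_lines_def isometry_def)
  let ?y = "inv_into UNIV x"
  have xy: "x (?y a) = a" "?y (x a) = a" for a
    using bij by (auto simp: bij_def surj_f_inv_f)
  have "linear ?y"
  proof (rule linearI)
    show "?y (a + b) = ?y a + ?y b" for a b
      using linear_add[OF lin, of "?y a" "?y b"] xy(2)[of "?y a + ?y b"] by (simp add: xy(1))
    show "?y (r *\<^sub>R a) = r *\<^sub>R ?y a" for r a
      using linear_cmul[OF lin, of r "?y a"] xy(2)[of "r *\<^sub>R ?y a"] by (simp add: xy(1))
  qed
  moreover have "bij ?y" using bij by (rule bij_imp_bij_inv)
  moreover have "\<alpha> (?y a) (?y b) = \<alpha> a b" for a b
    using iso[of "?y a" "?y b"] by (simp add: xy)
  moreover have "bij_betw (\<lambda>L. ?y ` L) (lines u) (lines u)"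
  proof (rule bij_betw_byWitness[where f' = "\<lambda>L. x ` L"])
    show "(\<lambda>L. ?y ` L) ` lines u \<subseteq> lines u"
    proof safe
      fix M assume "M \<in> lines u"
      then obtain N where "N \<in> lines u" "M = x ` N" using bij_betw_imp_surj_on[OF L] by blast
      then show "?y ` M \<in> lines u" by (simp add: image_image xy)
    qed
  qed (use L in \<open>auto simp: image_image xy bij_betw_def\<close>)
  ultimately have "?y \<in> carrier (Aut_lines \<alpha> u)"
    by (simp add: Aut_lines_def isometry_def)
  moreover have "?y \<otimes>\<^bsub>Aut_lines \<alpha> u\<^esub> x = \<one>\<^bsub>Aut_lines \<alpha> u\<^esub>"
    by (auto simp: Aut_lines_def xy)
  ultimately show "\<exists>y\<in>carrier (Aut_lines \<alpha> u). y \<otimes>\<^bsub>Aut_lines \<alpha> u\<^esub> x = \<one>\<^bsub>Aut_lines \<alpha> u\<^esub>" by blast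
qed (auto simp: Aut_lines_def comp_assoc)

lemma group_sgn_perm_group: "group (sgn_perm_group \<Gamma>)"
proof (rule groupI)
  fix x y
  assume x: "x \<in> carrier (sgn_perm_group \<Gamma>)" and y: "y \<in> carrier (sgn_perm_group \<Gamma>)"
  obtain \<sigma> \<nu> \<sigma>' \<nu>' where e: "x = (\<sigma>, \<nu>)" "y = (\<sigma>', \<nu>')" by fastforce
  have s: "\<nu> i * \<nu> j * sgn_adj \<Gamma> (\<sigma> i) (\<sigma> j) = sgn_adj \<Gamma> i j"
      "\<nu>' i * \<nu>' j * sgn_adj \<Gamma> (\<sigma>' i) (\<sigma>' j) = sgn_adj \<Gamma> i j" for i j
    using x y by (auto simp: e sgn_perm_group_def)
  have "\<nu> (\<sigma>' i) * \<nu>' i * (\<nu> (\<sigma>' j) * \<nu>' j) * sgn_adj \<Gamma> (\<sigma> (\<sigma>' i)) (\<sigma> (\<sigma>' j)) = sgn_adj \<Gamma> i j"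
    for i j
    using s(1)[of "\<sigma>' i" "\<sigma>' j"] s(2)[of i j] by (simp add: ac_simps)
  moreover have "\<nu> (\<sigma>' i) * \<nu>' i \<in> {-1, 1}" for i
  proof -
    have "\<nu> (\<sigma>' i) \<in> {-1, 1}" "\<nu>' i \<in> {-1, 1}"
      using x y by (auto simp: e sgn_perm_group_def)
    then show ?thesis by auto
  qed
  moreover have "bij (\<sigma> \<circ> \<sigma>')"
    using x y by (auto simp: e sgn_perm_group_def intro: bij_comp)
  ultimately show "x \<otimes>\<^bsub>sgn_perm_group \<Gamma>\<^esub> y \<in> carrier (sgn_perm_group \<Gamma>)"
    by (simp add: e sgn_perm_group_def)
next
  fix x assume x: "x \<in> carrier (sgn_perm_group \<Gamma>)"
  obtain \<sigma> \<nu> where e: "x = (\<sigma>, \<nu>)" by fastforce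
  have b: "bij \<sigma>" and v: "\<And>i. \<nu> i \<in> {-1, 1}"
    and s: "\<And>i j. \<nu> i * \<nu> j * sgn_adj \<Gamma> (\<sigma> i) (\<sigma> j) = sgn_adj \<Gamma> i j"
    using x by (auto simp: e sgn_perm_group_def)
  have i: "\<sigma> (inv_into UNIV \<sigma> a) = a" "inv_into UNIV \<sigma> (\<sigma> a) = a" for a
    using b by (auto simp: bij_def surj_f_inv_f)
  have v2: "\<nu> a * \<nu> a = 1" for a using v[of a] by auto
  let ?y = "(inv_into UNIV \<sigma>, \<lambda>i. \<nu> (inv_into UNIV \<sigma> i))"
  have "\<nu> (inv_into UNIV \<sigma> a) * \<nu> (inv_into UNIV \<sigma> d) * sgn_adj \<Gamma> (inv_into UNIV \<sigma> a) (inv_into UNIV \<sigma> d) = sgn_adj \<Gamma> a d" for a d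
  proof -
    have "\<nu> (inv_into UNIV \<sigma> a) * \<nu> (inv_into UNIV \<sigma> d) * sgn_adj \<Gamma> (inv_into UNIV \<sigma> a) (inv_into UNIV \<sigma> d) =
      (\<nu> (inv_into UNIV \<sigma> a) * \<nu> (inv_into UNIV \<sigma> a)) * (\<nu> (inv_into UNIV \<sigma> d) * \<nu> (inv_into UNIV \<sigma> d)) * sgn_adj \<Gamma> a d"
      using s[of "inv_into UNIV \<sigma> a" "inv_into UNIV \<sigma> d"] by (simp add: i ac_simps flip: s[of "inv_into UNIV \<sigma> a" "inv_into UNIV \<sigma> d"])
    then show ?thesis by (simp add: v2)
  qed
  then have "?y \<in> carrier (sgn_perm_group \<Gamma>)"
    using b v by (auto simp: sgn_perm_group_def bij_imp_bij_inv)
  moreover have "?y \<otimes>\<^bsub>sgn_perm_group \<Gamma>\<^esub> x = \<one>\<^bsub>sgn_perm_group \<Gamma>\<^esub>"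
    by (auto simp: sgn_perm_group_def e i v2)
  ultimately show "\<exists>y\<in>carrier (sgn_perm_group \<Gamma>).
      y \<otimes>\<^bsub>sgn_perm_group \<Gamma>\<^esub> x = \<one>\<^bsub>sgn_perm_group \<Gamma>\<^esub>" by blast
qed (auto simp: sgn_perm_group_def split: prod.splits)

lemma reduced_imp_spanning_nondegenerate:
  fixes \<alpha> :: "'a::real_vector \<Rightarrow> 'a \<Rightarrow> real" and u :: "'n::finite \<Rightarrow> 'a"
  assumes Q: "quadratic_space \<alpha>" and R: "reduced_representation \<alpha> u"
  shows "span (range u) = UNIV"
    and "linear (\<lambda>x. \<chi> i. \<alpha> (u i) x)"
    and "inj (\<lambda>x. \<chi> i. \<alpha> (u i) x)"
proof -
  define \<Phi> :: "'a \<Rightarrow> real^'n" where "\<Phi> = (\<lambda>x. \<chi> i. \<alpha> (u i) x)"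
  have bil: "bilinear \<alpha>" using Q by (simp add: quadratic_space_def)
  have lin: "linear \<Phi>"
    unfolding \<Phi>_def
    by (rule linearI) (auto simp: vec_eq_iff bilinear_radd[OF bil] bilinear_rmul[OF bil])
  obtain F :: "'a set" where F: "finite F" "span F = UNIV"
    using Q by (auto simp: quadratic_space_def)
  obtain B where B: "B \<subseteq> range u" "independent B" "range u \<subseteq> span B"
    using real_vector.basis_exists[of "range u"] by metis
  have finB: "finite B" by (rule finite_subset[OF B(1)]) simp
  have "columns (gram \<alpha> u) = \<Phi> ` range u"
    by (auto simp: columns_def column_def gram_def \<Phi>_def)
  moreover have "\<Phi> ` range u \<subseteq> span (\<Phi> ` B)"
    using B(3) linear_span_image[OF lin, of B] by blast
  ultimately have sp: "columns (gram \<alpha> u) \<subseteq> span (\<Phi> ` B)" by simp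
  have "dim (UNIV :: 'a set) = dim (columns (gram \<alpha> u))"
    using R by (simp add: reduced_representation_def column_rank_def)
  also have le1: "\<dots> \<le> dim (\<Phi> ` B)"
    using sp by (metis dim_span dim_subset)
  finally have d: "dim (UNIV :: 'a set) \<le> dim (\<Phi> ` B)" .
  have c1: "dim (\<Phi> ` B) \<le> card (\<Phi> ` B)" using finB by (simp add: dim_le_card')
  have c2: "card (\<Phi> ` B) \<le> card B" using finB by (rule card_image_le)
  obtain B' where B': "B \<subseteq> B'" "independent B'" "UNIV \<subseteq> span B'"
    using real_vector.maximal_independent_subset_extend[of B UNIV] B(2) by auto
  have finB': "finite B'"
    using real_vector.independent_span_bound[of F B'] F B'(2) by auto
  have "card B' = dim (UNIV :: 'a set)"
    using real_vector.basis_card_eq_dim[of B' UNIV] B'(2,3) by simp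
  then have cB': "card B' \<le> card B" using d c1 c2 by simp
  then have "B' = B" using card_seteq[OF finB' B'(1)] by simp
  then have spB: "span B = UNIV" using B' by auto
  show "span (range u) = UNIV"
    using spB real_vector.span_mono[OF B(1)] by auto
  show "linear (\<lambda>x. \<chi> i. \<alpha> (u i) x)" using lin by (simp add: \<Phi>_def)
  have eq: "card (\<Phi> ` B) = card B" "dim (\<Phi> ` B) = card (\<Phi> ` B)"
    using d c1 c2 \<open>card B' = dim UNIV\<close> \<open>B' = B\<close> by auto
  have "inj_on \<Phi> B" using eq(1) finB by (simp add: eq_card_imp_inj_on)
  moreover have "independent (\<Phi> ` B)"
    using eq(2) by (intro card_le_dim_spanning[where V = "span (\<Phi> ` B)"]) (auto simp: finB span_superset)
  ultimately have "inj_on \<Phi> (span B)"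
    using linear_inj_on_span_iff_independent_image[OF lin, of B] by blast
  then show "inj (\<lambda>x. \<chi> i. \<alpha> (u i) x)" by (simp add: spB \<Phi>_def)
qed

lemma ex1_induced_isometry:
  fixes \<alpha> :: "'a::real_vector \<Rightarrow> 'a \<Rightarrow> real" and u :: "'n::finite \<Rightarrow> 'a"
  assumes Q: "quadratic_space \<alpha>" and Rep: "graph_representation \<Gamma> \<alpha> u \<omega> c"
    and R: "reduced_representation \<alpha> u" and G: "(\<sigma>, \<nu>) \<in> carrier (sgn_perm_group \<Gamma>)"
  shows "\<exists>!\<phi>. isometry \<alpha> \<phi> \<and> (\<forall>i. \<phi> (u i) = \<nu> i *\<^sub>R u (\<sigma> i))"
proof -
  define \<Phi> :: "'a \<Rightarrow> real^'n" where "\<Phi> = (\<lambda>x. \<chi> i. \<alpha> (u i) x)"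
  have sp: "span (range u) = UNIV" and lin: "linear \<Phi>" and inj: "inj \<Phi>"
    using reduced_imp_spanning_nondegenerate[OF Q R] by (auto simp: \<Phi>_def)
  have bil: "bilinear \<alpha>" and sym: "\<And>x y. \<alpha> x y = \<alpha> y x"
    using Q by (auto simp: quadratic_space_def)
  have b: "bij \<sigma>" and v: "\<And>i. \<nu> i \<in> {-1, 1}"
    and s: "\<And>i j. \<nu> i * \<nu> j * sgn_adj \<Gamma> (\<sigma> i) (\<sigma> j) = sgn_adj \<Gamma> i j"
    using G by (auto simp: sgn_perm_group_def)
  have v2: "\<nu> i * \<nu> i = 1" for i using v[of i] by auto
  let ?\<tau> = "inv_into UNIV \<sigma>"
  have i: "\<sigma> (?\<tau> a) = a" "?\<tau> (\<sigma> a) = a" for a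
    using b by (auto simp: bij_def surj_f_inv_f)
  have g: "\<nu> i * \<nu> j * \<alpha> (u (\<sigma> i)) (u (\<sigma> j)) = \<alpha> (u i) (u j)" for i j
  proof (cases "i = j")
    case True
    then show ?thesis using Rep v2 by (simp add: graph_representation_def)
  next
    case False
    then have "\<sigma> i \<noteq> \<sigma> j" using b by (metis i(2))
    then have "\<alpha> (u (\<sigma> i)) (u (\<sigma> j)) = sgn_adj \<Gamma> (\<sigma> i) (\<sigma> j) * c"
      "\<alpha> (u i) (u j) = sgn_adj \<Gamma> i j * c"
      using Rep False by (auto simp: graph_representation_def)
    then show ?thesis using s[of i j] by (metis mult.assoc)
  qed
  define P :: "real^'n \<Rightarrow> real^'n" where "P = (\<lambda>w. \<chi> k. \<nu> (?\<tau> k) * w $ ?\<tau> k)"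
  have linP: "linear P"
    unfolding P_def by (rule linearI) (auto simp: vec_eq_iff algebra_simps)
  have Pu: "P (\<Phi> (u i)) = \<nu> i *\<^sub>R \<Phi> (u (\<sigma> i))" for i
  proof -
    have "\<nu> (?\<tau> k) * \<alpha> (u (?\<tau> k)) (u i) = \<nu> i * \<alpha> (u k) (u (\<sigma> i))" for k
    proof -
      have "\<nu> (?\<tau> k) * \<alpha> (u (?\<tau> k)) (u i)
          = (\<nu> (?\<tau> k) * \<nu> (?\<tau> k)) * (\<nu> i * \<alpha> (u k) (u (\<sigma> i)))"
        using g[of "?\<tau> k" i, symmetric] by (simp add: i(1) mult.assoc)
      then show ?thesis by (simp add: v2)
    qed
    then show ?thesis by (simp add: P_def \<Phi>_def vec_eq_iff)
  qed
  obtain \<Psi> where Psi: "linear \<Psi>" "\<Psi> \<circ> \<Phi> = id"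
    using linear_injective_left_inverse[OF lin inj] by blast
  define \<phi> where "\<phi> = \<Psi> \<circ> P \<circ> \<Phi>"
  have linphi: "linear \<phi>"
    unfolding \<phi>_def by (intro linear_compose lin linP Psi(1))
  have phiu: "\<phi> (u i) = \<nu> i *\<^sub>R u (\<sigma> i)" for i
    using Psi by (simp add: \<phi>_def Pu linear_cmul fun_eq_iff)
  have iso: "\<alpha> (\<phi> x) (\<phi> y) = \<alpha> x y" for x y
  proof (rule bilinear_eq[where f = "\<lambda>x y. \<alpha> (\<phi> x) (\<phi> y)" and g = \<alpha> and B = "range u"
        and S = UNIV and C = "range u" and T = UNIV])
    show "bilinear (\<lambda>x y. \<alpha> (\<phi> x) (\<phi> y))"
      using linphi bil unfolding bilinear_def linear_iff by simp
  next
    fix a d assume "a \<in> range u" "d \<in> range u"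
    then obtain i j where "a = u i" "d = u j" by blast
    then show "\<alpha> (\<phi> a) (\<phi> d) = \<alpha> a d"
      using g[of i j] by (simp add: phiu bilinear_lmul[OF bil] bilinear_rmul[OF bil] mult.left_commute mult.assoc)
  qed (auto simp: sp bil)
  have "inj \<phi>"
  proof (rule linear_injective_0[OF linphi, THEN iffD2], safe)
    fix x assume "\<phi> x = 0"
    then have "\<alpha> y x = 0" for y
      using iso[of y x] by (simp add: bilinear_rzero[OF bil])
    then have "\<Phi> x = \<Phi> 0" by (simp add: \<Phi>_def bilinear_rzero[OF bil])
    then show "x = 0" using inj by (simp add: inj_eq)
  qed
  moreover have "surj \<phi>"
  proof -
    have "u k \<in> range \<phi>" for k
    proof -
      have "\<phi> (\<nu> (?\<tau> k) *\<^sub>R u (?\<tau> k)) = u k"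
        by (simp add: linear_cmul[OF linphi] phiu i v2)
      then show ?thesis by (metis rangeI)
    qed
    then have "span (range u) \<subseteq> range \<phi>"
      by (intro real_vector.span_minimal linear_subspace_image[OF linphi]) auto
    then show ?thesis using sp by auto
  qed
  ultimately have "isometry \<alpha> \<phi>"
    using linphi iso by (simp add: isometry_def bij_def)
  moreover have "\<psi> = \<phi>" if "isometry \<alpha> \<psi>" "\<forall>i. \<psi> (u i) = \<nu> i *\<^sub>R u (\<sigma> i)" for \<psi>
  proof
    fix x show "\<psi> x = \<phi> x"
      by (rule linear_eq_on[of \<psi> \<phi> x "range u"])
        (use that linphi sp phiu in \<open>auto simp: isometry_def\<close>)
  qed
  ultimately show ?thesis using phiu by blast
qed

end

theory Submission
  imports Defs
begin

text \<open>
  The elements of \<open>G\<close> are exactly the signed permutations of the vectors \<open>u\<^sub>1, \<dots>, u\<^sub>n\<close> that preserve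
  the Gram matrix, so the point of the first claim is that an isometry \<open>\<phi>\<close> permuting the lines must
  permute the vectors up to sign. A priori \<open>\<phi> (u\<^sub>i) = \<lambda>\<^sub>i u\<^bsub>\<sigma>(i)\<^esub>\<close> with arbitrary scalars
  \<open>\<lambda>\<^sub>i\<close>. If \<open>\<omega> \<noteq> 0\<close>, comparing norms gives \<open>\<lambda>\<^sub>i\<^sup>2 = 1\<close>, but isotropic lines carry no such information.
  What works for every \<open>\<omega>\<close> is to compare the products of distinct vectors: they all have the
  absolute value \<open>\<bar>c\<bar> \<noteq> 0\<close>, hence \<open>\<bar>\<lambda>\<^sub>i \<lambda>\<^sub>j\<bar> = 1\<close> whenever \<open>i \<noteq> j\<close>, and three distinct indices
  force \<open>\<bar>\<lambda>\<^sub>i\<bar> = 1\<close>. This gives surjectivity of \<open>f\<close> (\<open>Aut_lines_signed_permutation\<close>).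
  Injectivity holds because distinct lines determine \<open>\<sigma>\<close> and then nonzero vectors determine \<open>\<nu>\<close>
  (\<open>inj_on_induced_isometry\<close>), while multiplicativity follows from the uniqueness of \<open>f\<^bsub>\<sigma>,\<nu>\<^esub>\<close>
  (\<open>induced_isometry_hom\<close>).

  For the second claim, if \<open>u\<^sub>j = t u\<^sub>i\<close> then \<open>t\<^sup>2 \<omega> = \<omega>\<close> and \<open>t \<omega> = \<plusminus>c \<noteq> 0\<close>; hence
  \<open>t = \<plusminus>1\<close> and \<open>\<bar>\<omega>\<bar> = \<bar>c\<bar>\<close>.
\<close>

section \<open>Signs, vectors and lines of a representation\<close>

lemma abs_sgn_adj: "\<bar>sgn_adj \<Gamma> i j\<bar> = 1"
  by (simp add: sgn_adj_def)

lemma sgn_adj_same: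
  assumes "simple_graph \<Gamma>"
  shows "sgn_adj \<Gamma> i i = 1"
proof -
  have "{i, i} \<notin> \<Gamma>"
    using assms unfolding simple_graph_def by (metis doubleton_eq_iff)
  then show ?thesis by (simp add: sgn_adj_def)
qed

text \<open>
  When \<open>\<omega> = 0\<close> the vector is isotropic, so it is its product with a second vector of the
  representation that shows it to be nonzero.
\<close>
lemma graph_representation_nonzero:
  fixes \<Gamma> :: "'n::finite set set" and u :: "'n \<Rightarrow> 'a::real_vector"
  assumes bil: "bilinear \<alpha>" and Rep: "graph_representation \<Gamma> \<alpha> u \<omega> c"
    and c: "c \<noteq> 0" and n: "CARD('n) \<ge> 2"
  shows "u i \<noteq> 0"
proof
  assume 0: "u i = 0"
  have "\<exists>j. j \<noteq> i"
  proof (rule ccontr)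
    assume "\<not> (\<exists>j. j \<noteq> i)"
    then have "(UNIV :: 'n set) = {i}" by auto
    then have "CARD('n) = 1" by (metis card_1_singleton_iff One_nat_def)
    then show False using n by simp
  qed
  then obtain j where "j \<noteq> i" by blast
  then have "\<alpha> (u i) (u j) = sgn_adj \<Gamma> i j * c"
    using Rep by (auto simp: graph_representation_def)
  then show False
    using c abs_sgn_adj[of \<Gamma> i j] by (auto simp: 0 bilinear_lzero[OF bil])
qed

lemma line_eq_imp_scaled:
  assumes "line u i = line u j"
  obtains t where "u j = t *\<^sub>R u i"
proof -
  have "u j \<in> line u i" by (simp add: assms) (simp add: line_def span_base)
  then show thesis using that by (auto simp: line_def span_singleton)
qed

lemma span_singleton_scaleR:
  fixes x :: "'a::real_vector"
  assumes "r \<noteq> 0"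
  shows "span {r *\<^sub>R x} = span {x}"
proof -
  have "x \<in> span {r *\<^sub>R x}"
    using span_scale[OF span_base[of "r *\<^sub>R x" "{r *\<^sub>R x}"], of "inverse r"] assms by simp
  moreover have "r *\<^sub>R x \<in> span {x}"
    by (simp add: span_base span_scale)
  ultimately show ?thesis
    by (simp add: span_eq)
qed

lemma abs_eq_one_of_pairwise_products:
  fixes a b d :: real
  assumes "\<bar>a * b\<bar> = 1" "\<bar>a * d\<bar> = 1" "\<bar>b * d\<bar> = 1"
  shows "\<bar>a\<bar> = 1"
proof -
  have "\<bar>a\<bar>\<^sup>2 * \<bar>b * d\<bar> = \<bar>a * b\<bar> * \<bar>a * d\<bar>"
    by (simp add: abs_mult power2_eq_square mult_ac)
  then have "\<bar>a\<bar>\<^sup>2 = 1"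
    unfolding assms by simp
  then show ?thesis
    by (auto simp: power2_eq_1_iff)
qed

section \<open>The homomorphism from signed permutations to isometries\<close>

lemma induced_isometry_props:
  fixes \<alpha> :: "'a::real_vector \<Rightarrow> 'a \<Rightarrow> real" and u :: "'n::finite \<Rightarrow> 'a"
  assumes "quadratic_space \<alpha>" "graph_representation \<Gamma> \<alpha> u \<omega> c" "reduced_representation \<alpha> u"
    and G: "(\<sigma>, \<nu>) \<in> carrier (sgn_perm_group \<Gamma>)"
  shows "isometry \<alpha> (induced_isometry \<alpha> u (\<sigma>, \<nu>))"
    and "induced_isometry \<alpha> u (\<sigma>, \<nu>) (u i) = \<nu> i *\<^sub>R u (\<sigma> i)"
    and "isometry \<alpha> \<phi> \<Longrightarrow> (\<And>i. \<phi> (u i) = \<nu> i *\<^sub>R u (\<sigma> i)) \<Longrightarrow> induced_isometry \<alpha> u (\<sigma>, \<nu>) = \<phi>"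
proof -
  note ex1 = ex1_induced_isometry[OF assms]
  show "isometry \<alpha> (induced_isometry \<alpha> u (\<sigma>, \<nu>))"
    and "induced_isometry \<alpha> u (\<sigma>, \<nu>) (u i) = \<nu> i *\<^sub>R u (\<sigma> i)"
    using theI'[OF ex1] by (auto simp: induced_isometry_def)
  show "induced_isometry \<alpha> u (\<sigma>, \<nu>) = \<phi>"
    if "isometry \<alpha> \<phi>" "\<And>i. \<phi> (u i) = \<nu> i *\<^sub>R u (\<sigma> i)"
    using the1_equality[OF ex1, of \<phi>] that by (simp add: induced_isometry_def)
qed

lemma signed_permutation_in_Aut_lines:
  assumes iso: "isometry \<alpha> \<phi>" and \<sigma>: "bij \<sigma>"
    and \<nu>: "\<And>i. \<nu> i \<noteq> 0" and \<phi>u: "\<And>i. \<phi> (u i) = \<nu> i *\<^sub>R u (\<sigma> i)"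
  shows "\<phi> \<in> carrier (Aut_lines \<alpha> u)"
proof -
  have lin: "linear \<phi>" and inj: "inj \<phi>"
    using iso by (auto simp: isometry_def bij_def)
  have im: "\<phi> ` line u i = line u (\<sigma> i)" for i
    using image_line[OF lin, of u i] span_singleton_scaleR[OF \<nu>[of i], of "u (\<sigma> i)"]
    by (simp add: line_def \<phi>u)
  have "(\<lambda>L. \<phi> ` L) ` lines u = range (line u \<circ> \<sigma>)"
    by (simp add: lines_def image_image im)
  also have "\<dots> = lines u"
    using \<sigma> by (metis lines_def image_comp bij_is_surj)
  finally have "bij_betw (\<lambda>L. \<phi> ` L) (lines u) (lines u)"
    using inj by (simp add: bij_betw_def inj_on_def inj_image_eq_iff)
  then show ?thesis
    using iso by (simp add: Aut_lines_def)
qed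

lemma sgn_perm_group_carrierD:
  assumes "(\<sigma>, \<nu>) \<in> carrier (sgn_perm_group \<Gamma>)"
  shows "bij \<sigma>" and "\<nu> i \<noteq> 0"
proof -
  have "\<nu> i \<in> {-1, 1}" "bij \<sigma>" using assms by (auto simp: sgn_perm_group_def)
  then show "bij \<sigma>" "\<nu> i \<noteq> 0" by auto
qed

lemma induced_isometry_hom:
  fixes \<alpha> :: "'a::real_vector \<Rightarrow> 'a \<Rightarrow> real" and u :: "'n::finite \<Rightarrow> 'a"
  assumes H: "quadratic_space \<alpha>" "graph_representation \<Gamma> \<alpha> u \<omega> c" "reduced_representation \<alpha> u"
  shows "induced_isometry \<alpha> u \<in> hom (sgn_perm_group \<Gamma>) (Aut_lines \<alpha> u)"
proof (rule homI)
  fix x assume x: "x \<in> carrier (sgn_perm_group \<Gamma>)"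
  obtain \<sigma> \<nu> where e: "x = (\<sigma>, \<nu>)" by fastforce
  note g = x[unfolded e]
  show "induced_isometry \<alpha> u x \<in> carrier (Aut_lines \<alpha> u)"
    unfolding e using induced_isometry_props(1,2)[OF H g] sgn_perm_group_carrierD[OF g]
    by (intro signed_permutation_in_Aut_lines[where \<sigma> = \<sigma> and \<nu> = \<nu>])
next
  fix x y assume x: "x \<in> carrier (sgn_perm_group \<Gamma>)" and y: "y \<in> carrier (sgn_perm_group \<Gamma>)"
  obtain \<sigma> \<nu> \<sigma>' \<nu>' where e: "x = (\<sigma>, \<nu>)" "y = (\<sigma>', \<nu>')" by fastforce
  note gx = x[unfolded e] and gy = y[unfolded e]
  have m: "x \<otimes>\<^bsub>sgn_perm_group \<Gamma>\<^esub> y = (\<sigma> \<circ> \<sigma>', \<lambda>i. \<nu> (\<sigma>' i) * \<nu>' i)"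
    by (simp add: sgn_perm_group_def e)
  have gxy: "(\<sigma> \<circ> \<sigma>', \<lambda>i. \<nu> (\<sigma>' i) * \<nu>' i) \<in> carrier (sgn_perm_group \<Gamma>)"
    using monoid.m_closed[OF group.is_monoid[OF group_sgn_perm_group] x y] m by simp
  let ?f = "induced_isometry \<alpha> u x" and ?g = "induced_isometry \<alpha> u y"
  have f: "isometry \<alpha> ?f" and g: "isometry \<alpha> ?g"
    unfolding e by (rule induced_isometry_props(1)[OF H] gx gy)+
  have "isometry \<alpha> (?f \<circ> ?g)"
    using f g by (simp add: isometry_def linear_compose bij_comp del: o_apply) (simp add: o_def)
  moreover have "(?f \<circ> ?g) (u i) = (\<nu> (\<sigma>' i) * \<nu>' i) *\<^sub>R u ((\<sigma> \<circ> \<sigma>') i)" for i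
  proof -
    have "linear ?f" using f by (simp add: isometry_def)
    then show ?thesis
      using induced_isometry_props(2)[OF H gx] induced_isometry_props(2)[OF H gy]
      by (simp add: e linear_cmul mult.commute)
  qed
  ultimately show "induced_isometry \<alpha> u (x \<otimes>\<^bsub>sgn_perm_group \<Gamma>\<^esub> y) = ?f \<otimes>\<^bsub>Aut_lines \<alpha> u\<^esub> ?g"
    using induced_isometry_props(3)[OF H gxy] by (simp add: m Aut_lines_def)
qed

lemma inj_on_induced_isometry:
  fixes \<alpha> :: "'a::real_vector \<Rightarrow> 'a \<Rightarrow> real" and u :: "'n::finite \<Rightarrow> 'a"
  assumes H: "quadratic_space \<alpha>" "graph_representation \<Gamma> \<alpha> u \<omega> c" "reduced_representation \<alpha> u"
    and inj: "inj (line u)" and u0: "\<And>i. u i \<noteq> 0"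
  shows "inj_on (induced_isometry \<alpha> u) (carrier (sgn_perm_group \<Gamma>))"
proof (rule inj_onI)
  fix x y assume x: "x \<in> carrier (sgn_perm_group \<Gamma>)" and y: "y \<in> carrier (sgn_perm_group \<Gamma>)"
    and eq: "induced_isometry \<alpha> u x = induced_isometry \<alpha> u y"
  obtain \<sigma> \<nu> \<sigma>' \<nu>' where e: "x = (\<sigma>, \<nu>)" "y = (\<sigma>', \<nu>')" by fastforce
  note gx = x[unfolded e] and gy = y[unfolded e]
  have v: "\<nu> i *\<^sub>R u (\<sigma> i) = \<nu>' i *\<^sub>R u (\<sigma>' i)" for i
    using eq induced_isometry_props(2)[OF H gx, of i] induced_isometry_props(2)[OF H gy, of i]
    by (simp add: e)
  have \<sigma>: "\<sigma> i = \<sigma>' i" for i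
  proof -
    have "line u (\<sigma> i) = line u (\<sigma>' i)"
      using v[of i] span_singleton_scaleR[OF sgn_perm_group_carrierD(2)[OF gx], of i "u (\<sigma> i)"]
        span_singleton_scaleR[OF sgn_perm_group_carrierD(2)[OF gy], of i "u (\<sigma>' i)"]
      by (simp add: line_def)
    then show ?thesis using inj by (simp add: inj_eq)
  qed
  moreover have "\<nu> i = \<nu>' i" for i
    using v[of i] u0 by (simp add: \<sigma>)
  ultimately show "x = y" by (auto simp: e)
qed

section \<open>Isometries permuting the lines are signed permutations\<close>

text \<open>
  Since distinct vectors have products \<open>\<plusminus>c \<noteq> 0\<close>, invariance of \<open>\<alpha>\<close> only determines the absolute values of the products
  \<open>\<nu>\<^sub>i \<nu>\<^sub>j\<close> with \<open>i \<noteq> j\<close>; with two vertices and \<open>\<omega> = 0\<close>, the scalars \<open>2\<close> and \<open>1/2\<close> would be possible.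
  A third vertex excludes this.
\<close>
lemma Aut_lines_signed_permutation:
  fixes \<Gamma> :: "'n::finite set set" and u :: "'n \<Rightarrow> 'a::real_vector"
  assumes graph: "simple_graph \<Gamma>" and n: "CARD('n) \<ge> 3"
    and bil: "bilinear \<alpha>" and Rep: "graph_representation \<Gamma> \<alpha> u \<omega> c" and c: "c \<noteq> 0"
    and inj: "inj (line u)" and \<phi>: "\<phi> \<in> carrier (Aut_lines \<alpha> u)"
  obtains \<sigma> \<nu> where "(\<sigma>, \<nu>) \<in> carrier (sgn_perm_group \<Gamma>)" "\<And>i. \<phi> (u i) = \<nu> i *\<^sub>R u (\<sigma> i)"
proof -
  have lin: "linear \<phi>" and inj\<phi>: "inj \<phi>" and iso: "\<And>x y. \<alpha> (\<phi> x) (\<phi> y) = \<alpha> x y"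
    and perm: "(\<lambda>L. \<phi> ` L) ` lines u = lines u"
    using \<phi> by (auto simp: Aut_lines_def isometry_def bij_betw_def)
  have "\<exists>k. \<phi> ` line u i = line u k" for i
    using perm unfolding lines_def by blast
  then obtain \<sigma> where \<sigma>: "\<And>i. \<phi> ` line u i = line u (\<sigma> i)" by metis
  have "inj \<sigma>"
  proof (rule injI)
    fix i j assume "\<sigma> i = \<sigma> j"
    then have "\<phi> ` line u i = \<phi> ` line u j" by (simp add: \<sigma>)
    then show "i = j" using inj inj\<phi> by (simp add: inj_image_eq_iff inj_eq)
  qed
  then have bij: "bij \<sigma>" by (simp add: bij_def finite_UNIV_inj_surj)
  have "\<exists>t. \<phi> (u i) = t *\<^sub>R u (\<sigma> i)" for i
  proof -
    have "\<phi> (u i) \<in> line u (\<sigma> i)"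
      unfolding \<sigma>[symmetric] by (intro imageI) (simp add: line_def span_base)
    then show ?thesis by (auto simp: line_def span_singleton)
  qed
  then obtain \<nu> where \<nu>: "\<And>i. \<phi> (u i) = \<nu> i *\<^sub>R u (\<sigma> i)" by metis
  have prod: "\<nu> i * \<nu> j * sgn_adj \<Gamma> (\<sigma> i) (\<sigma> j) = sgn_adj \<Gamma> i j" if "i \<noteq> j" for i j
  proof -
    have "\<sigma> i \<noteq> \<sigma> j" using that \<open>inj \<sigma>\<close> by (simp add: inj_eq)
    then have "\<nu> i * \<nu> j * (sgn_adj \<Gamma> (\<sigma> i) (\<sigma> j) * c) = sgn_adj \<Gamma> i j * c"
      using iso[of "u i" "u j"] Rep that
      by (simp add: \<nu> graph_representation_def bilinear_lmul[OF bil] bilinear_rmul[OF bil] mult_ac)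
    then show ?thesis using c by (simp add: mult.assoc[symmetric])
  qed
  have abs_prod: "\<bar>\<nu> i * \<nu> j\<bar> = 1" if "i \<noteq> j" for i j
    using arg_cong[OF prod[OF that], of abs] by (simp add: abs_mult abs_sgn_adj)
  have abs: "\<bar>\<nu> i\<bar> = 1" for i
  proof -
    have "card (UNIV - {i}) \<ge> 2" using n by simp
    then obtain S where "S \<subseteq> UNIV - {i}" "card S = 2"
      by (meson obtain_subset_with_card_n)
    then obtain j k where "j \<noteq> k" "i \<noteq> j" "i \<noteq> k"
      by (auto simp: card_2_iff)
    then show ?thesis
      by (intro abs_eq_one_of_pairwise_products[of "\<nu> i" "\<nu> j" "\<nu> k"] abs_prod)
  qed
  have sign: "\<nu> i \<in> {-1, 1}" for i
    using abs[of i] by (auto simp: abs_if split: if_splits)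
  have "\<nu> i * \<nu> j * sgn_adj \<Gamma> (\<sigma> i) (\<sigma> j) = sgn_adj \<Gamma> i j" for i j
  proof (cases "i = j")
    case True
    have "\<nu> i * \<nu> i = 1" using sign[of i] by auto
    then show ?thesis by (simp add: True[symmetric] sgn_adj_same[OF graph])
  qed (rule prod)
  then have "(\<sigma>, \<nu>) \<in> carrier (sgn_perm_group \<Gamma>)"
    using bij sign by (simp add: sgn_perm_group_def)
  then show thesis using \<nu> by (rule that)
qed

section \<open>Coinciding lines\<close>

lemma abs_parameters_eq_if_lines_coincide:
  assumes bil: "bilinear \<alpha>" and Rep: "graph_representation \<Gamma> \<alpha> u \<omega> c" and c: "c \<noteq> 0"
    and ij: "i \<noteq> j" and eq: "line u i = line u j"
  shows "\<bar>\<omega>\<bar> = \<bar>c\<bar>"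
proof -
  obtain t where t: "u j = t *\<^sub>R u i" by (rule line_eq_imp_scaled[OF eq])
  have "\<alpha> (u i) (u i) = \<omega>" "\<alpha> (u j) (u j) = \<omega>"
    using Rep by (auto simp: graph_representation_def)
  then have norms: "t * (t * \<omega>) = \<omega>"
    by (simp add: t bilinear_lmul[OF bil] bilinear_rmul[OF bil])
  have "\<alpha> (u i) (u j) = t * \<omega>"
    using Rep by (simp add: t bilinear_rmul[OF bil] graph_representation_def)
  then have off: "t * \<omega> = sgn_adj \<Gamma> i j * c"
    using Rep ij by (simp add: graph_representation_def)
  have abs_off: "\<bar>t\<bar> * \<bar>\<omega>\<bar> = \<bar>c\<bar>"
    using arg_cong[OF off, of abs] by (simp add: abs_mult abs_sgn_adj)
  then have "\<omega> \<noteq> 0" using c by auto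
  then have "t\<^sup>2 = 1" using norms by (simp add: power2_eq_square flip: mult.assoc)
  then have "\<bar>t\<bar> = 1" by (auto simp: power2_eq_1_iff)
  then show ?thesis using abs_off by simp
qed

theorem mainTheorem2:
  fixes \<Gamma> :: "'n::finite set set"
    and \<alpha> :: "'a::real_vector \<Rightarrow> 'a \<Rightarrow> real"
    and u :: "'n \<Rightarrow> 'a"
    and \<omega> c :: real
  assumes "simple_graph \<Gamma>"
    and "CARD('n) \<ge> 3"
    and "quadratic_space \<alpha>"
    and "graph_representation \<Gamma> \<alpha> u \<omega> c"
    and "reduced_representation \<alpha> u"
    and "c \<noteq> 0"
  shows "((\<forall>i j. i \<noteq> j \<longrightarrow> line u i \<noteq> line u j) \<longrightarrow>
      induced_isometry \<alpha> u \<in> iso (sgn_perm_group \<Gamma>) (Aut_lines \<alpha> u) \<and>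
      sgn_perm_group \<Gamma> \<cong> rep_group \<Gamma> \<alpha> u \<and>
      rep_group \<Gamma> \<alpha> u = Aut_lines \<alpha> u) \<and>
    (\<bar>\<omega>\<bar> \<noteq> \<bar>c\<bar> \<longrightarrow> (\<forall>i j. i \<noteq> j \<longrightarrow> line u i \<noteq> line u j))"
proof -
  note H = \<open>quadratic_space \<alpha>\<close> \<open>graph_representation \<Gamma> \<alpha> u \<omega> c\<close> \<open>reduced_representation \<alpha> u\<close>
  have bil: "bilinear \<alpha>" using H(1) by (simp add: quadratic_space_def)
  have "induced_isometry \<alpha> u \<in> iso (sgn_perm_group \<Gamma>) (Aut_lines \<alpha> u) \<and>
      sgn_perm_group \<Gamma> \<cong> rep_group \<Gamma> \<alpha> u \<and> rep_group \<Gamma> \<alpha> u = Aut_lines \<alpha> u"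
    if "\<forall>i j. i \<noteq> j \<longrightarrow> line u i \<noteq> line u j"
  proof -
    have inj: "inj (line u)" using that by (auto simp: inj_def)
    have u0: "u i \<noteq> 0" for i
      using graph_representation_nonzero[OF bil H(2) \<open>c \<noteq> 0\<close>] \<open>CARD('n) \<ge> 3\<close> by simp
    have hom: "induced_isometry \<alpha> u \<in> hom (sgn_perm_group \<Gamma>) (Aut_lines \<alpha> u)"
      by (rule induced_isometry_hom[OF H])
    have "\<phi> \<in> induced_isometry \<alpha> u ` carrier (sgn_perm_group \<Gamma>)"
      if \<phi>: "\<phi> \<in> carrier (Aut_lines \<alpha> u)" for \<phi>
    proof -
      obtain \<sigma> \<nu> where g: "(\<sigma>, \<nu>) \<in> carrier (sgn_perm_group \<Gamma>)"
        and "\<And>i. \<phi> (u i) = \<nu> i *\<^sub>R u (\<sigma> i)"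
        using Aut_lines_signed_permutation[OF assms(1,2) bil H(2) \<open>c \<noteq> 0\<close> inj \<phi>] by blast
      moreover have "isometry \<alpha> \<phi>" using \<phi> by (simp add: Aut_lines_def)
      ultimately have "induced_isometry \<alpha> u (\<sigma>, \<nu>) = \<phi>"
        using induced_isometry_props(3)[OF H g] by blast
      then show ?thesis using g by blast
    qed
    moreover have "induced_isometry \<alpha> u ` carrier (sgn_perm_group \<Gamma>) \<subseteq> carrier (Aut_lines \<alpha> u)"
      using hom by (auto simp: hom_def)
    ultimately have surj: "induced_isometry \<alpha> u ` carrier (sgn_perm_group \<Gamma>) = carrier (Aut_lines \<alpha> u)"
      by blast
    have iso: "induced_isometry \<alpha> u \<in> iso (sgn_perm_group \<Gamma>) (Aut_lines \<alpha> u)"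
      using hom inj_on_induced_isometry[OF H inj u0] surj by (simp add: iso_def bij_betw_def)
    moreover have "rep_group \<Gamma> \<alpha> u = Aut_lines \<alpha> u"
      by (simp add: rep_group_def surj)
    ultimately show ?thesis by (auto intro: is_isoI)
  qed
  moreover have "line u i \<noteq> line u j" if "\<bar>\<omega>\<bar> \<noteq> \<bar>c\<bar>" "i \<noteq> j" for i j
    using abs_parameters_eq_if_lines_coincide[OF bil H(2) \<open>c \<noteq> 0\<close>] that by blast
  ultimately show ?thesis by blast
qed

end
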